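(* Let $G$ be a finite, simple, connected graph whose Laplacian $L=D-A$ has exactly two distinct non-zero eigenvalues $\theta_1\neq\theta_2$. If $G$ is neither a complete bipartite graph $K_{m,m}$ with $m\geq 2$ nor a star $K_{1,p}$ with $p\geq 2$, then the exponent of the critical group $\mathcal{K}(G)$ equals $\theta_1\theta_2$. If $G=K_{m,m}$ ($m\geq 2$), the exponent of $\mathcal{K}(G)$ equals $\theta_1\theta_2/2$. If $G=K_{1,p}$ ($p\geq2$), the exponent of $\mathcal{K}(G)$ equals $\theta_1\theta_2/(p+1)$.
   Context: For a graph $G$ on vertex set $\{1,\dots,n\}$, the Laplacian is $L=D-A$, where $D$ is the diagonal matrix of vertex degrees and $A$ the adjacency matrix. The critical group $\mathcal{K}(G)$ is the torsion part of the cokernel of $L$ over $\mathbb{Z}$, equivalently $\{\mathbf{u}\in\mathbb{Z}^n:\sum_i\mathbf{u}_i=0\}/\operatorname{row}_{\mathbb{Z}}L$. The exponent of a finite abelian group is the least positive integer annihilating every element (the maximum order of an element). *)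

theory Defs
  imports
    "HOL-Algebra.Coset"
    "Jordan_Normal_Form.Char_Poly"
    "Graph_Theory.Digraph_Component"
    "Graph_Theory.Kuratowski"
begin

text \<open>
  Simple graphs are the symmetric, loopfree digraphs without multiple arcs of the locale
  \<^term>\<open>graph\<close>: an undirected edge is a pair of opposite arcs. Matrices and vectors are
  indexed from 0, so a graph with n vertices is taken on the vertex set \<open>{..<n}\<close>.
\<close>

text \<open>Since arcs come in opposite pairs, the out-degree is the degree in the undirected sense.\<close>

definition degree_matrix :: "nat \<Rightarrow> (nat, 'b) pre_digraph \<Rightarrow> int mat" where
  "degree_matrix n G = mat n n (\<lambda>(i, j). if i = j then int (out_degree G i) else 0)"

definition adjacency_matrix :: "nat \<Rightarrow> (nat, 'b) pre_digraph \<Rightarrow> int mat" where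
  "adjacency_matrix n G = mat n n (\<lambda>(i, j). if (i, j) \<in> arcs_ends G then 1 else 0)"

definition laplacian :: "nat \<Rightarrow> (nat, 'b) pre_digraph \<Rightarrow> int mat" where
  "laplacian n G = degree_matrix n G - adjacency_matrix n G"

definition cokernel :: "int mat \<Rightarrow> int vec set monoid" where
  "cokernel A = monoid_vec TYPE(int) (dim_row A) Mod ((\<lambda>x. A *\<^sub>v x) ` carrier_vec (dim_col A))"

definition torsion_part :: "('a, 'c) monoid_scheme \<Rightarrow> ('a, 'c) monoid_scheme" where
  "torsion_part H = H\<lparr>carrier := {x \<in> carrier H. \<exists>k::nat. k > 0 \<and> x [^]\<^bsub>H\<^esub> k = \<one>\<^bsub>H\<^esub>}\<rparr>"

text \<open>The Laplacian is symmetric, so its column lattice, which is factored out here, is also its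
  row lattice.\<close>

definition critical_group :: "nat \<Rightarrow> (nat, 'b) pre_digraph \<Rightarrow> int vec set monoid" where
  "critical_group n G = torsion_part (cokernel (laplacian n G))"

text \<open>Only meaningful for groups of bounded exponent, in particular for finite groups.\<close>

definition group_exponent :: "('a, 'c) monoid_scheme \<Rightarrow> nat" where
  "group_exponent H = (LEAST k::nat. k > 0 \<and> (\<forall>x\<in>carrier H. x [^]\<^bsub>H\<^esub> k = \<one>\<^bsub>H\<^esub>))"

end

theory Submission
  imports Defs
begin

text \<open>
  The operator \<open>L (L - \<theta>\<^sub>1) (L - \<theta>\<^sub>2)\<close> vanishes because \<open>L\<close> is symmetric, and by connectedness the kernel
  of \<open>L\<close> consists of the constant vectors. Hence \<open>L\<^sup>2 - s L + p I = \<mu> J\<close> with \<open>J\<close> the all-ones matrix,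
  \<open>s = \<theta>\<^sub>1 + \<theta>\<^sub>2\<close> and \<open>p = \<theta>\<^sub>1 \<theta>\<^sub>2 = n \<mu>\<close>. Since \<open>\<theta>\<^sub>1 \<noteq> \<theta>\<^sub>2\<close>, the graph is not complete, and \<open>\<mu>\<close> is the number
  of common neighbours of any two nonadjacent vertices; in particular \<open>s\<close>, \<open>p\<close> and \<open>\<mu>\<close> are integers.

  Put \<open>N = s I - L\<close>, so that \<open>N L = L N = p I - \<mu> J\<close>. Then \<open>k\<close> annihilates the torsion of the cokernel
  of \<open>L\<close> iff \<open>p\<close> divides \<open>k\<close> times every mixed second difference of the entries of \<open>N\<close>. If some \<open>h > 1\<close>
  divides all these differences, then nonadjacent vertices are twins and there are no triangles, so the
  graph is complete bipartite, and the constancy of \<open>\<mu>\<close> leaves only \<open>K\<^sub>m\<^sub>,\<^sub>m\<close> and stars.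
\<close>

section \<open>Polynomials of a symmetric matrix\<close>

text \<open>Vectors are functions vanishing from \<open>n\<close> on, so that equality of vectors is
  equality of functions; the default 0 keeps images in this form.\<close>

definition mat_act :: "nat \<Rightarrow> (nat \<Rightarrow> nat \<Rightarrow> complex) \<Rightarrow> (nat \<Rightarrow> complex) \<Rightarrow> nat \<Rightarrow> complex" where
  "mat_act n M f = (\<lambda>j. if j < n then \<Sum>k<n. M j k * f k else 0)"

text \<open>Horner's scheme for \<open>p\<close> evaluated at \<open>M\<close> and applied to
  \<open>w\<close>; no matrix powers are formed.\<close>

definition poly_act ::
  "nat \<Rightarrow> (nat \<Rightarrow> nat \<Rightarrow> complex) \<Rightarrow> complex poly \<Rightarrow> (nat \<Rightarrow> complex) \<Rightarrow> nat \<Rightarrow> complex" where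
  "poly_act n M p w = fold_coeffs (\<lambda>c u j. c * w j + mat_act n M u j) p (\<lambda>_. 0)"

lemma mat_act_add: "mat_act n M (\<lambda>j. f j + g j) = (\<lambda>j. mat_act n M f j + mat_act n M g j)"
  by (auto simp: mat_act_def algebra_simps sum.distrib)

lemma mat_act_scale: "mat_act n M (\<lambda>j. c * f j) = (\<lambda>j. c * mat_act n M f j)"
  by (auto simp: mat_act_def algebra_simps sum_distrib_left)

lemma mat_act_0: "mat_act n M (\<lambda>_. 0) = (\<lambda>_. 0)"
  by (auto simp: mat_act_def)

lemma mat_act_sum:
  "mat_act n M (\<lambda>j. \<Sum>i\<in>I. f i j) = (\<lambda>j. \<Sum>i\<in>I. mat_act n M (f i) j)"
  by (induction I rule: infinite_finite_induct) (simp_all add: mat_act_0 mat_act_add)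

lemma poly_act_0: "poly_act n M 0 w = (\<lambda>_. 0)"
  by (simp add: poly_act_def)

lemma poly_act_pCons:
  "poly_act n M (pCons c q) w = (\<lambda>j. c * w j + mat_act n M (poly_act n M q w) j)"
  by (cases "c = 0 \<and> q = 0") (auto simp: poly_act_def mat_act_0)

lemma poly_act_support: "\<forall>j\<ge>n. w j = 0 \<Longrightarrow> j \<ge> n \<Longrightarrow> poly_act n M p w j = 0"
  by (induction p) (auto simp: poly_act_0 poly_act_pCons mat_act_def)

lemma poly_act_add:
  "poly_act n M (p + q) w = (\<lambda>j. poly_act n M p w j + poly_act n M q w j)"
  by (induction p q rule: poly_induct2)
    (simp_all add: poly_act_0 poly_act_pCons mat_act_add algebra_simps)

lemma poly_act_smult: "poly_act n M (Polynomial.smult c p) w = (\<lambda>j. c * poly_act n M p w j)"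
  by (induction p) (simp_all add: poly_act_0 poly_act_pCons mat_act_scale algebra_simps)

text \<open>Factorisations of polynomials thereby become factorisations of operators.\<close>

lemma poly_act_mult: "poly_act n M (p * q) w = poly_act n M p (poly_act n M q w)"
  by (induction p) (simp_all add: poly_act_0 poly_act_pCons poly_act_add poly_act_smult)

lemma poly_act_linear: "poly_act n M [:c, 1:] w = (\<lambda>j. c * w j + mat_act n M w j)"
  by (simp add: poly_act_pCons poly_act_0 mat_act_0)

lemma poly_act_Poly:
  "poly_act n M (Poly cs) w = (\<lambda>j. \<Sum>i<length cs. cs ! i * (mat_act n M ^^ i) w j)"
proof (induction cs)
  case (Cons c cs)
  then show ?case
    by (simp add: poly_act_pCons sum.lessThan_Suc_shift mat_act_sum mat_act_scale del: sum.lessThan_Suc)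
qed (simp add: poly_act_0)

text \<open>The \<open>n\<close> equations in \<open>n + 1\<close> unknowns are padded with a zero
  row. Expanding along that row shows the square matrix to be singular.\<close>

lemma homogeneous_system_nontrivial:
  fixes V :: "nat \<Rightarrow> nat \<Rightarrow> 'a::field"
  obtains c where "\<exists>i<Suc n. c i \<noteq> 0" and "\<forall>j<n. (\<Sum>i<Suc n. c i * V i j) = 0"
proof -
  define A where "A = mat (Suc n) (Suc n) (\<lambda>(j, i). if j < n then V i j else 0)"
  have A: "A \<in> carrier_mat (Suc n) (Suc n)" by (simp add: A_def)
  have "det A = (\<Sum>i<Suc n. A $$ (n, i) * cofactor A n i)"
    using A by (rule laplace_expansion_row) simp
  also have "\<dots> = 0"
    by (intro sum.neutral) (simp add: A_def)
  finally have "det A = 0" .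
  then obtain v where v: "v \<in> carrier_vec (Suc n)" "v \<noteq> 0\<^sub>v (Suc n)" "A *\<^sub>v v = 0\<^sub>v (Suc n)"
    using det_0_iff_vec_prod_zero_field[OF A] by blast
  have "\<exists>i<Suc n. v $ i \<noteq> 0"
    using v(1,2) by (auto simp: vec_eq_iff)
  moreover have "(\<Sum>i<Suc n. v $ i * V i j) = 0" if "j < n" for j
  proof -
    have "(A *\<^sub>v v) $ j = 0" using v(3) that by simp
    then show ?thesis
      using that v(1) by (simp add: A_def scalar_prod_def atLeast0LessThan mult.commute)
  qed
  ultimately show thesis by (intro that) auto
qed

text \<open>
  If \<open>p = (X - l) r\<close> has minimal degree among the polynomials that annihilate \<open>w\<close>, then \<open>r\<close> applied to \<open>w\<close>
  is an eigenvector.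
\<close>

lemma poly_act_eigenvector:
  assumes w: "w j \<noteq> 0" and supp: "\<forall>j\<ge>n. w j = 0"
  obtains r l where "poly_act n M r w \<noteq> (\<lambda>_. 0)"
    and "mat_act n M (poly_act n M r w) = (\<lambda>j. l * poly_act n M r w j)"
proof -
  \<comment> \<open>The \<open>n + 1\<close> iterates of \<open>w\<close> under \<open>M\<close>
    have only \<open>n\<close> coordinates, so they are dependent; a dependency is a nonzero
    polynomial annihilating \<open>w\<close>.\<close>
  obtain c where c: "\<exists>i<Suc n. c i \<noteq> 0"
    and c0: "\<forall>j<n. (\<Sum>i<Suc n. c i * (mat_act n M ^^ i) w j) = 0"
    using homogeneous_system_nontrivial[where n = n and V = "\<lambda>i. (mat_act n M ^^ i) w"] .
  define q where "q = Poly (map c [0..<Suc n])"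
  have "poly_act n M q w j = 0" for j
  proof (cases "j < n")
    case True
    have "poly_act n M q w j = (\<Sum>i<Suc n. map c [0..<Suc n] ! i * (mat_act n M ^^ i) w j)"
      by (simp add: q_def poly_act_Poly del: upt_Suc)
    also have "\<dots> = (\<Sum>i<Suc n. c i * (mat_act n M ^^ i) w j)"
      by (intro sum.cong) (simp_all add: nth_map_upt del: upt_Suc)
    finally show ?thesis using c0 True by simp
  qed (use supp poly_act_support in auto)
  moreover have "q \<noteq> 0"
  proof -
    obtain i where "i < Suc n" "c i \<noteq> 0" using c by auto
    then have "coeff q i \<noteq> 0"
      by (simp add: q_def coeff_Poly_eq nth_default_def del: upt_Suc)
    then show ?thesis by auto
  qed
  ultimately have ex: "q \<noteq> 0 \<and> poly_act n M q w = (\<lambda>_. 0)" by auto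
  define p where "p = (ARG_MIN degree p. p \<noteq> 0 \<and> poly_act n M p w = (\<lambda>_. 0))"
  have p: "p \<noteq> 0" "poly_act n M p w = (\<lambda>_. 0)"
    using arg_min_natI[where m = degree and P = "\<lambda>p. p \<noteq> 0 \<and> poly_act n M p w = (\<lambda>_. 0)", OF ex]
    by (auto simp: p_def)
  have min: "degree p \<le> degree r" if "r \<noteq> 0" "poly_act n M r w = (\<lambda>_. 0)" for r
    unfolding p_def by (rule arg_min_nat_le) (use that in auto)
  \<comment> \<open>A nonzero constant cannot annihilate \<open>w\<close>, so \<open>p\<close> has a
    complex root.\<close>
  have "degree p \<noteq> 0"
  proof
    assume "degree p = 0"
    then obtain a where "p = [:a:]" by (rule degree_eq_zeroE)
    with p w show False by (auto simp: poly_act_pCons poly_act_0 mat_act_0 fun_eq_iff)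
  qed
  then obtain l where "poly p l = 0"
    using fundamental_theorem_of_algebra[of p] by (auto simp: constant_degree)
  then obtain r where r: "p = [:- l, 1:] * r"
    by (auto simp: poly_eq_0_iff_dvd)
  then have "r \<noteq> 0"
    using p by auto
  moreover from this have "degree p = Suc (degree r)"
    unfolding r by (subst degree_mult_eq) simp_all
  ultimately have "poly_act n M r w \<noteq> (\<lambda>_. 0)"
    using min[of r] by auto
  moreover have "mat_act n M (poly_act n M r w) j = l * poly_act n M r w j" for j
    using fun_cong[OF p(2), of j] unfolding r poly_act_mult poly_act_linear by simp
  ultimately show thesis by (intro that) auto
qed

text \<open>Conjugation fixes the real entries, and symmetry does the rest. Used both to show that
  an eigenvalue is real and to move the operator across the Hermitian form.\<close>

lemma mat_act_symmetric:
  fixes M :: "nat \<Rightarrow> nat \<Rightarrow> real"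
  assumes "\<And>i j. i < n \<Longrightarrow> j < n \<Longrightarrow> M i j = M j i"
  shows "(\<Sum>j<n. cnj (f j) * mat_act n (\<lambda>i j. of_real (M i j)) g j) =
    (\<Sum>j<n. cnj (mat_act n (\<lambda>i j. of_real (M i j)) f j) * g j)"
proof -
  have "(\<Sum>j<n. cnj (f j) * mat_act n (\<lambda>i j. of_real (M i j)) g j) =
      (\<Sum>j<n. \<Sum>k<n. cnj (f j) * of_real (M j k) * g k)"
    by (simp add: mat_act_def sum_distrib_left mult.assoc)
  also have "\<dots> = (\<Sum>k<n. \<Sum>j<n. cnj (f j) * of_real (M j k) * g k)"
    by (rule sum.swap)
  also have "\<dots> = (\<Sum>k<n. \<Sum>j<n. cnj (of_real (M k j) * f j) * g k)"
    using assms by (intro sum.cong refl) (simp add: mult.commute)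
  also have "\<dots> = (\<Sum>j<n. cnj (mat_act n (\<lambda>i j. of_real (M i j)) f j) * g j)"
    by (simp add: mat_act_def sum_distrib_right)
  finally show ?thesis .
qed

lemma hermitian_norm_eq_0:
  fixes u :: "nat \<Rightarrow> complex"
  assumes "(\<Sum>j<n. cnj (u j) * u j) = 0" "\<forall>j\<ge>n. u j = 0"
  shows "u = (\<lambda>_. 0)"
proof
  fix j
  have "complex_of_real (\<Sum>j<n. (cmod (u j))\<^sup>2) = (\<Sum>j<n. cnj (u j) * u j)"
    by (simp add: complex_norm_square mult.commute del: of_real_power)
  then have "(\<Sum>j<n. (cmod (u j))\<^sup>2) = 0"
    using assms(1) of_real_eq_0_iff by metis
  then show "u j = 0"
    using assms(2) by (cases "j < n") (simp_all add: sum_nonneg_eq_0_iff)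
qed

text \<open>An eigenvector in the image of \<open>\<Prod>(M - e)\<close> would lie both in the kernel and in the image of
  the self-adjoint operator \<open>M - e\<close> for some \<open>e\<close>, hence be orthogonal to itself.\<close>

lemma symmetric_annihilated:
  fixes M :: "nat \<Rightarrow> nat \<Rightarrow> real"
  assumes sym: "\<And>i j. i < n \<Longrightarrow> j < n \<Longrightarrow> M i j = M j i"
    and ev: "\<And>e f i. i < n \<Longrightarrow> f i \<noteq> 0 \<Longrightarrow> (\<And>j. j < n \<Longrightarrow> (\<Sum>k<n. M j k * f k) = e * f j) \<Longrightarrow> e \<in> E"
    and "finite E" and supp: "\<forall>j\<ge>n. v j = 0"
  shows "poly_act n (\<lambda>i j. of_real (M i j)) (\<Prod>e\<in>E. [:- of_real e, 1:]) v = (\<lambda>_. 0)"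
proof (rule ccontr)
  define C where "C = (\<lambda>i j. complex_of_real (M i j))"
  define P where "P = (\<Prod>e\<in>E. [:- complex_of_real e, 1:])"
  assume "\<not> ?thesis"
  then obtain j where j: "poly_act n C P v j \<noteq> 0" by (auto simp: C_def P_def)
  obtain r l where u0: "poly_act n C r (poly_act n C P v) \<noteq> (\<lambda>_. 0)"
    and eig: "mat_act n C (poly_act n C r (poly_act n C P v)) =
      (\<lambda>j. l * poly_act n C r (poly_act n C P v) j)"
    using poly_act_eigenvector[where w = "poly_act n C P v" and j = j] j poly_act_support supp
    by metis
  define u where "u = poly_act n C r (poly_act n C P v)"
  have u_supp: "\<forall>j\<ge>n. u j = 0"
    unfolding u_def using poly_act_support supp by blast
  define N where "N = (\<Sum>j<n. cnj (u j) * u j)"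
  have N0: "N \<noteq> 0"
    using hermitian_norm_eq_0 u_supp u0 by (auto simp: N_def u_def)
  have Tu: "mat_act n C u = (\<lambda>j. l * u j)" using eig by (simp add: u_def)
  have "l * N = (\<Sum>j<n. cnj (u j) * mat_act n C u j)"
    by (simp add: Tu N_def sum_distrib_left algebra_simps)
  also have "\<dots> = (\<Sum>j<n. cnj (mat_act n C u j) * u j)"
    unfolding C_def using sym by (rule mat_act_symmetric)
  also have "\<dots> = cnj l * N"
    by (simp add: Tu N_def sum_distrib_left algebra_simps)
  finally have "l = cnj l" using N0 by simp
  then obtain e where e: "l = of_real e" by (metis Reals_cnj_iff Reals_cases)
  obtain i where i: "u i \<noteq> 0" using u0 by (auto simp: u_def)
  then have "i < n" using u_supp not_less by blast
  have act: "(\<Sum>k<n. of_real (M j k) * u k) = of_real e * u j" if "j < n" for j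
    using fun_cong[OF Tu, of j] that by (simp add: mat_act_def C_def e)
  have "(\<Sum>k<n. M j k * Re (u k)) = e * Re (u j)" "(\<Sum>k<n. M j k * Im (u k)) = e * Im (u j)"
    if "j < n" for j
    using arg_cong[OF act[OF that], of Re] arg_cong[OF act[OF that], of Im] by simp_all
  \<comment> \<open>The real and imaginary parts of \<open>u\<close> both satisfy the eigenvalue
    equation, and one of them is nonzero at \<open>i\<close>.\<close>
  then have "e \<in> E"
    using ev[of i "\<lambda>j. Re (u j)" e] ev[of i "\<lambda>j. Im (u j)" e] i \<open>i < n\<close> by (auto simp: complex_eq_iff)
  \<comment> \<open>Splitting off the factor for \<open>e\<close> exhibits \<open>u\<close> as
    \<open>(M - l) x\<close>.\<close>
  then have "P = [:- l, 1:] * (\<Prod>e\<in>E - {e}. [:- complex_of_real e, 1:])"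
    using \<open>finite E\<close> by (simp add: P_def e prod.remove)
  then have "r * P = [:- l, 1:] * (r * (\<Prod>e\<in>E - {e}. [:- complex_of_real e, 1:]))"
    by (simp only: mult.left_commute)
  then obtain x where x: "u = poly_act n C [:- l, 1:] x"
    unfolding u_def by (metis poly_act_mult)
  \<comment> \<open>\<open><u, (M - l) x> = <(M - l) u, x> = 0\<close>, because \<open>l\<close> is
    real.\<close>
  have "N = (\<Sum>j<n. cnj (u j) * mat_act n C x j) - l * (\<Sum>j<n. cnj (u j) * x j)"
    unfolding N_def by (subst (2) x)
      (simp add: poly_act_linear sum_distrib_left sum_subtractf algebra_simps)
  also have "(\<Sum>j<n. cnj (u j) * mat_act n C x j) = (\<Sum>j<n. cnj (mat_act n C u j) * x j)"
    unfolding C_def using sym by (rule mat_act_symmetric)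
  also have "\<dots> = cnj l * (\<Sum>j<n. cnj (u j) * x j)"
    by (simp add: Tu sum_distrib_left algebra_simps)
  finally show False using N0 \<open>l = cnj l\<close> by simp
qed

section \<open>Laplacians with two nonzero eigenvalues\<close>

locale adjacency =
  fixes n :: nat and a :: "nat \<Rightarrow> nat \<Rightarrow> int"
  assumes a_01: "i < n \<Longrightarrow> j < n \<Longrightarrow> a i j = 0 \<or> a i j = 1"
    and a_sym: "i < n \<Longrightarrow> j < n \<Longrightarrow> a i j = a j i"
    and a_irrefl: "i < n \<Longrightarrow> a i i = 0"
begin

definition deg :: "nat \<Rightarrow> int" where
  "deg i = (\<Sum>k<n. a i k)"

definition lap :: "nat \<Rightarrow> nat \<Rightarrow> int" where
  "lap i j = (if i = j then deg i else 0) - a i j"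

definition is_ev :: "real \<Rightarrow> bool" where
  "is_ev e \<longleftrightarrow> (\<exists>f. (\<exists>i<n. f i \<noteq> 0) \<and> (\<forall>j<n. (\<Sum>k<n. real_of_int (lap j k) * f k) = e * f j))"

definition bipartition :: "nat set \<Rightarrow> nat set \<Rightarrow> bool" where
  "bipartition U V \<longleftrightarrow> U \<union> V = {..<n} \<and> U \<inter> V = {} \<and>
    (\<forall>i<n. \<forall>j<n. a i j = 1 \<longleftrightarrow> (i, j) \<in> U \<times> V \<union> V \<times> U)"

section \<open>Identities for the Laplacian and its square\<close>

lemma lap_sym: "i < n \<Longrightarrow> j < n \<Longrightarrow> lap i j = lap j i"
  by (auto simp: lap_def a_sym)

text \<open>The degree is a row sum, so its contribution spreads over the neighbours. The ring is
  arbitrary because both integer and real vectors occur.\<close>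

lemma lap_apply:
  fixes f :: "nat \<Rightarrow> 'r::comm_ring_1"
  assumes "i < n"
  shows "(\<Sum>k<n. of_int (lap i k) * f k) = (\<Sum>k<n. of_int (a i k) * (f i - f k))"
proof -
  have "(\<Sum>k<n. of_int (lap i k) * f k) =
      (\<Sum>k<n. (if k = i then of_int (deg i) * f i else 0) - of_int (a i k) * f k)"
    by (intro sum.cong refl) (auto simp: lap_def algebra_simps)
  also have "\<dots> = of_int (deg i) * f i - (\<Sum>k<n. of_int (a i k) * f k)"
    using assms by (simp add: sum_subtractf)
  also have "\<dots> = (\<Sum>k<n. of_int (a i k) * (f i - f k))"
    by (simp add: deg_def sum_distrib_left algebra_simps sum_subtractf)
  finally show ?thesis .
qed

text \<open>By symmetry the columns sum to zero like the rows. This later forces torsion vectors to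
  have coordinate sum zero.\<close>

lemma lap_col_sum: "(\<Sum>i<n. \<Sum>k<n. lap i k * f k) = 0"
proof -
  have "(\<Sum>i<n. \<Sum>k<n. lap i k * f k) = (\<Sum>k<n. \<Sum>i<n. lap i k * f k)"
    by (rule sum.swap)
  also have "\<dots> = (\<Sum>k<n. f k * (\<Sum>i<n. lap k i * 1))"
    unfolding sum_distrib_left by (intro sum.cong refl) (simp add: lap_sym)
  also have "\<dots> = 0"
    using lap_apply[where f = "\<lambda>_. 1 :: int"] by simp
  finally show ?thesis .
qed

text \<open>Expansion of \<open>(D - A)^2\<close>; the last sum counts the common neighbours of
  \<open>i\<close> and \<open>j\<close>.\<close>

lemma lap_square:
  assumes "i < n" "j < n"
  shows "(\<Sum>k<n. lap i k * lap k j) =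
    (if i = j then (deg i)\<^sup>2 else 0) - (deg i + deg j) * a i j + (\<Sum>k<n. a i k * a k j)"
proof -
  have "(\<Sum>k<n. lap i k * lap k j) = (\<Sum>k<n. (if i = k then (if i = j then (deg i)\<^sup>2 else 0) else 0)
      - (if k = i then deg i * a i j else 0) - (if k = j then a i j * deg j else 0) + a i k * a k j)"
    by (intro sum.cong refl) (auto simp: lap_def algebra_simps power2_eq_square)
  also have "\<dots> = (if i = j then (deg i)\<^sup>2 else 0) - (deg i + deg j) * a i j + (\<Sum>k<n. a i k * a k j)"
    using assms by (simp add: sum.distrib sum_subtractf algebra_simps)
  finally show ?thesis .
qed

end

text \<open>Connectedness is stated through functions constant along edges, the form that the kernel
  computation uses.\<close>

locale two_eigenvalues = adjacency +
  fixes t\<^sub>1 t\<^sub>2 :: real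
  assumes conn: "\<And>(f :: nat \<Rightarrow> real) i j. (\<And>i j. i < n \<Longrightarrow> j < n \<Longrightarrow> a i j = 1 \<Longrightarrow> f i = f j)
      \<Longrightarrow> i < n \<Longrightarrow> j < n \<Longrightarrow> f i = f j"
    and spec: "is_ev e \<and> e \<noteq> 0 \<longleftrightarrow> e = t\<^sub>1 \<or> e = t\<^sub>2"
    and t_neq: "t\<^sub>1 \<noteq> t\<^sub>2"
begin

text \<open>Twice the quadratic form of \<open>L\<close> at \<open>f\<close> is the sum of
  \<open>a i k * (f i - f k)^2\<close> over ordered pairs. It vanishes here, so \<open>f\<close>
  agrees across every edge.\<close>

lemma lap_kernel:
  fixes f :: "nat \<Rightarrow> real"
  assumes f: "\<And>i. i < n \<Longrightarrow> (\<Sum>k<n. real_of_int (lap i k) * f k) = 0" and "i < n" "j < n"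
  shows "f i = f j"
proof (rule conn)
  have "(\<Sum>i<n. \<Sum>k<n. real_of_int (a i k) * (f i - f k)\<^sup>2) =
      (\<Sum>i<n. \<Sum>k<n. real_of_int (a i k) * (f i - f k) * f i) +
      (\<Sum>i<n. \<Sum>k<n. real_of_int (a i k) * (f k - f i) * f k)"
    by (simp add: algebra_simps power2_eq_square flip: sum.distrib)
  also have "(\<Sum>i<n. \<Sum>k<n. real_of_int (a i k) * (f k - f i) * f k) =
      (\<Sum>k<n. \<Sum>i<n. real_of_int (a i k) * (f k - f i) * f k)"
    by (rule sum.swap)
  also have "\<dots> = (\<Sum>k<n. \<Sum>i<n. real_of_int (a k i) * (f k - f i) * f k)"
    by (intro sum.cong refl) (simp add: a_sym)
  also have "(\<Sum>i<n. \<Sum>k<n. real_of_int (a i k) * (f i - f k) * f i) = 0"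
  proof (rule sum.neutral, rule ballI)
    fix i assume "i \<in> {..<n}"
    then show "(\<Sum>k<n. real_of_int (a i k) * (f i - f k) * f i) = 0"
      using f[of i] lap_apply[of i f] unfolding sum_distrib_right[symmetric] by simp
  qed
  finally have "(\<Sum>i<n. \<Sum>k<n. real_of_int (a i k) * (f i - f k)\<^sup>2) = 0" by simp
  moreover have nonneg: "0 \<le> real_of_int (a i k) * (f i - f k)\<^sup>2" if "i < n" "k < n" for i k
    using a_01[OF that] by auto
  moreover have "0 \<le> (\<Sum>k<n. real_of_int (a i k) * (f i - f k)\<^sup>2)" if "i < n" for i
    using that nonneg by (intro sum_nonneg) simp
  ultimately have "\<forall>i\<in>{..<n}. (\<Sum>k<n. real_of_int (a i k) * (f i - f k)\<^sup>2) = 0"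
    using sum_nonneg_eq_0_iff[of "{..<n}" "\<lambda>i. \<Sum>k<n. real_of_int (a i k) * (f i - f k)\<^sup>2"]
    by simp
  then have "\<forall>i<n. \<forall>k\<in>{..<n}. real_of_int (a i k) * (f i - f k)\<^sup>2 = 0"
    using sum_nonneg_eq_0_iff[of "{..<n}" "\<lambda>k. real_of_int (a i k) * (f i - f k)\<^sup>2" for i] nonneg
    by simp
  then have "real_of_int (a i j) * (f i - f j)\<^sup>2 = 0" if "i < n" "j < n" for i j
    using that by blast
  then show "f i = f j" if "i < n" "j < n" "a i j = 1" for i j
    using that by force
qed fact+

text \<open>The columns of \<open>(L - t\<^sub>1) (L - t\<^sub>2)\<close> lie in the kernel of
  \<open>L\<close>, hence are constant, and by symmetry all entries agree. In a row sum only the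
  identity term survives, which gives \<open>t\<^sub>1 * t\<^sub>2\<close>.\<close>

lemma lap_quadratic_real:
  obtains c where "c * real n = t\<^sub>1 * t\<^sub>2"
    and "\<forall>i<n. \<forall>j<n. (\<Sum>k<n. real_of_int (lap i k) * real_of_int (lap k j))
      - (t\<^sub>1 + t\<^sub>2) * lap i j + (if i = j then t\<^sub>1 * t\<^sub>2 else 0) = c"
proof -
  define M where "M = (\<lambda>i j. real_of_int (lap i j))"
  \<comment> \<open>\<open>g j i\<close> is the entry of
    \<open>(L - t\<^sub>1) (L - t\<^sub>2)\<close> in row \<open>i\<close> and column
    \<open>j\<close>.\<close>
  define g where "g = (\<lambda>j i. (\<Sum>k<n. M i k * M k j) - (t\<^sub>1 + t\<^sub>2) * M i j + (if i = j then t\<^sub>1 * t\<^sub>2 else 0))"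
  have t0: "t\<^sub>1 \<noteq> 0" "t\<^sub>2 \<noteq> 0" "is_ev t\<^sub>1"
    using spec[of t\<^sub>1] spec[of t\<^sub>2] by simp_all
  have npos: "0 < n" using t0(3) by (auto simp: is_ev_def)
  have Lg: "(\<Sum>i<n. M l i * g j i) = 0" if jl: "j < n" "l < n" for j l
  proof -
    define C where "C = (\<lambda>i j. complex_of_real (M i j))"
    \<comment> \<open>The unit vector that picks out column \<open>j\<close>.\<close>
    define v where "v = (\<lambda>i. if i = j then 1 else 0 :: complex)"
    have "poly_act n C (\<Prod>e\<in>{0, t\<^sub>1, t\<^sub>2}. [:- complex_of_real e, 1:]) v = (\<lambda>_. 0)"
      unfolding C_def
    proof (rule symmetric_annihilated)
      show "M i j = M j i" if "i < n" "j < n" for i j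
        using that by (simp add: M_def lap_sym)
      show "e \<in> {0, t\<^sub>1, t\<^sub>2}" if "i < n" "f i \<noteq> 0" "\<And>j. j < n \<Longrightarrow> (\<Sum>k<n. M j k * f k) = e * f j" for e f i
      proof -
        have "is_ev e" unfolding is_ev_def M_def[symmetric]
          using that by (intro exI[of _ f]) (auto simp: M_def)
        then show ?thesis using spec[of e] by blast
      qed
    qed (use jl in \<open>auto simp: v_def\<close>)
    also have "(\<Prod>e\<in>{0, t\<^sub>1, t\<^sub>2}. [:- complex_of_real e, 1:]) =
        [:0, 1:] * ([:- complex_of_real t\<^sub>1, 1:] * [:- complex_of_real t\<^sub>2, 1:])"
      using t0 t_neq by simp
    finally have "mat_act n C (poly_act n C ([:- complex_of_real t\<^sub>1, 1:] * [:- complex_of_real t\<^sub>2, 1:]) v) l = 0"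
      by (simp only: poly_act_mult poly_act_linear fun_eq_iff) simp
    moreover have "poly_act n C ([:- complex_of_real t\<^sub>1, 1:] * [:- complex_of_real t\<^sub>2, 1:]) v i = of_real (g j i)"
      if "i < n" for i
    proof -
      have act_v: "mat_act n C v k = of_real (M k j)" if "k < n" for k
        using that jl by (simp add: mat_act_def v_def C_def if_distrib sum.If_cases cong: if_cong)
      have "mat_act n C (\<lambda>j. - complex_of_real t\<^sub>2 * v j + mat_act n C v j) i =
          - of_real t\<^sub>2 * mat_act n C v i + mat_act n C (mat_act n C v) i"
        by (simp only: mat_act_add mat_act_scale)
      also have "mat_act n C (mat_act n C v) i = of_real (\<Sum>k<n. M i k * M k j)"
        using that act_v by (subst mat_act_def) (simp add: C_def)
      finally show ?thesis
        using that act_v unfolding poly_act_mult poly_act_linear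
        by (simp add: g_def v_def algebra_simps)
    qed
    ultimately have "(\<Sum>i<n. C l i * of_real (g j i)) = 0"
      using jl by (simp add: mat_act_def)
    then have "complex_of_real (\<Sum>i<n. M l i * g j i) = 0"
      by (simp add: C_def)
    then show ?thesis by (simp only: of_real_eq_0_iff)
  qed
  have g_const: "g j i = g j 0" if "i < n" "j < n" for i j
    using lap_kernel[of "g j" i 0] Lg that npos by (simp add: M_def)
  have g_sym: "g j i = g i j" if "i < n" "j < n" for i j
    using that by (auto simp: g_def M_def lap_sym mult.commute intro!: sum.cong)
  have g: "g j i = g 0 0" if "i < n" "j < n" for i j
    using g_const[of i j] g_const[of j 0] g_sym[of j 0] that npos by simp
  have row: "(\<Sum>k<n. M i k) = 0" if "i < n" for i
    using lap_apply[of i "\<lambda>_. 1 :: real"] that by (simp add: M_def)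
  have "(\<Sum>j<n. g j 0) = (\<Sum>j<n. \<Sum>k<n. M 0 k * M k j) - (t\<^sub>1 + t\<^sub>2) * (\<Sum>j<n. M 0 j) + t\<^sub>1 * t\<^sub>2"
    using npos by (simp add: g_def sum.distrib sum_subtractf sum_distrib_left)
  also have "(\<Sum>j<n. \<Sum>k<n. M 0 k * M k j) = (\<Sum>k<n. M 0 k * (\<Sum>j<n. M k j))"
    by (subst sum.swap) (simp add: sum_distrib_left)
  finally have "(\<Sum>j<n. g j 0) = t\<^sub>1 * t\<^sub>2" using row npos by simp
  moreover have "(\<Sum>j<n. g j 0) = (\<Sum>j<n. g 0 0)"
    by (rule sum.cong[OF refl], rule g) (use npos in auto)
  ultimately have "g 0 0 * real n = t\<^sub>1 * t\<^sub>2" by (simp add: mult.commute)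
  moreover have "\<forall>i<n. \<forall>j<n. (\<Sum>k<n. real_of_int (lap i k) * real_of_int (lap k j))
      - (t\<^sub>1 + t\<^sub>2) * lap i j + (if i = j then t\<^sub>1 * t\<^sub>2 else 0) = g 0 0"
    using g unfolding g_def M_def by blast
  ultimately show thesis by (rule that)
qed

text \<open>On a complete graph \<open>L f\<close> is \<open>n f\<close> minus the sum of
  \<open>f\<close>. Summing coordinates shows that an eigenvector for a nonzero eigenvalue has sum
  zero, so that \<open>n\<close> would be the only such eigenvalue.\<close>

lemma nonadjacent_pair: "\<exists>i<n. \<exists>j<n. i \<noteq> j \<and> a i j = 0"
proof (rule ccontr)
  assume "\<not> ?thesis"
  then have adj: "a i j = (if i = j then 0 else 1)" if "i < n" "j < n" for i j
    using a_01 a_irrefl that by fastforce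
  have "e = real n" if "is_ev e" "e \<noteq> 0" for e
  proof -
    obtain f i where i: "i < n" "f i \<noteq> 0"
      and f: "\<And>j. j < n \<Longrightarrow> (\<Sum>k<n. real_of_int (lap j k) * f k) = e * f j"
      using \<open>is_ev e\<close> by (auto simp: is_ev_def)
    have *: "e * f j = real n * f j - (\<Sum>k<n. f k)" if "j < n" for j
    proof -
      have "e * f j = (\<Sum>k<n. real_of_int (a j k) * (f j - f k))"
        using f that lap_apply[of j f] by simp
      also have "\<dots> = (\<Sum>k<n. f j - f k)"
        using that by (intro sum.cong) (auto simp: adj)
      finally show ?thesis by (simp add: sum_subtractf)
    qed
    have "e * (\<Sum>j<n. f j) = (\<Sum>j<n. real n * f j - (\<Sum>k<n. f k))"
      by (simp add: sum_distrib_left *)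
    also have "\<dots> = 0"
      by (simp add: sum_subtractf sum_distrib_left)
    finally have "(\<Sum>k<n. f k) = 0" using \<open>e \<noteq> 0\<close> by simp
    with *[OF i(1)] i(2) show ?thesis by simp
  qed
  moreover have "is_ev t\<^sub>1 \<and> t\<^sub>1 \<noteq> 0" "is_ev t\<^sub>2 \<and> t\<^sub>2 \<noteq> 0"
    by (simp_all add: spec)
  ultimately have "t\<^sub>1 = real n" "t\<^sub>2 = real n"
    by blast+
  with t_neq show False by simp
qed

text \<open>Integrality is read off single entries. At a nonadjacent pair \<open>L\<close> vanishes,
  and the constant is a number of common neighbours; at an edge the entry of \<open>L\<close> is -1,
  which isolates \<open>t\<^sub>1 + t\<^sub>2\<close>.\<close>

lemma lap_quadratic:
  obtains s p \<mu> :: int where "0 < \<mu>" "p = int n * \<mu>" "real_of_int p = t\<^sub>1 * t\<^sub>2"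
    and "\<forall>i<n. \<forall>j<n.
      (\<Sum>k<n. lap i k * lap k j) = s * lap i j - (if i = j then p else 0) + \<mu>"
proof -
  obtain c where cn: "c * real n = t\<^sub>1 * t\<^sub>2"
    and c': "\<forall>i<n. \<forall>j<n. (\<Sum>k<n. real_of_int (lap i k) * real_of_int (lap k j))
      - (t\<^sub>1 + t\<^sub>2) * lap i j + (if i = j then t\<^sub>1 * t\<^sub>2 else 0) = c"
    using lap_quadratic_real .
  have c: "real_of_int (\<Sum>k<n. lap i k * lap k j)
      - (t\<^sub>1 + t\<^sub>2) * lap i j + (if i = j then t\<^sub>1 * t\<^sub>2 else 0) = c" if "i < n" "j < n" for i j
    using c' that by simp
  obtain x y where xy: "x < n" "y < n" "x \<noteq> y" "a x y = 0"
    using nonadjacent_pair by blast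
  define \<mu> where "\<mu> = (\<Sum>k<n. a x k * a k y)"
  have c_eq: "c = real_of_int \<mu>"
  proof -
    have "(\<Sum>k<n. lap x k * lap k y) = \<mu>"
      using lap_square[of x y] xy by (simp add: \<mu>_def)
    moreover have "lap x y = 0" using xy by (simp add: lap_def)
    ultimately show ?thesis using c[OF xy(1,2)] xy(3) by (simp del: of_int_sum)
  qed
  have "t\<^sub>1 \<noteq> 0" "t\<^sub>2 \<noteq> 0" using spec by blast+
  then have "\<mu> \<noteq> 0" using cn c_eq by auto
  moreover have "0 \<le> \<mu>"
    unfolding \<mu>_def
  proof (rule sum_nonneg)
    show "0 \<le> a x k * a k y" if "k \<in> {..<n}" for k
      using a_01[of x k] a_01[of k y] xy that by auto
  qed
  ultimately have "0 < \<mu>" by simp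
  \<comment> \<open>A common neighbour of \<open>x\<close> and \<open>y\<close> supplies an edge at
    \<open>x\<close>.\<close>
  obtain z where z: "z < n" "a x z * a z y \<noteq> 0"
    using \<open>\<mu> \<noteq> 0\<close> unfolding \<mu>_def by (meson lessThan_iff sum.neutral)
  then have xz: "a x z = 1" "x \<noteq> z" using a_01[of x z] a_irrefl xy(1) by auto
  define s where "s = \<mu> - (\<Sum>k<n. lap x k * lap k z)"
  have s: "t\<^sub>1 + t\<^sub>2 = real_of_int s"
    using c[of x z] xy(1) z(1) xz by (simp add: s_def c_eq lap_def del: of_int_sum)
  define p where "p = int n * \<mu>"
  have p: "t\<^sub>1 * t\<^sub>2 = real_of_int p" using cn c_eq by (simp add: p_def mult.commute)
  show thesis
  proof (rule that[OF \<open>0 < \<mu>\<close> p_def p[symmetric]], intro allI impI)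
    fix i j assume ij: "i < n" "j < n"
    have "real_of_int (\<Sum>k<n. lap i k * lap k j) =
        real_of_int (s * lap i j - (if i = j then p else 0) + \<mu>)"
      using c[OF ij] unfolding c_eq s p by (auto simp del: of_int_sum)
    then show "(\<Sum>k<n. lap i k * lap k j) = s * lap i j - (if i = j then p else 0) + \<mu>"
      by (simp only: of_int_eq_iff)
  qed
qed

end

section \<open>Annihilators of the torsion of the cokernel\<close>

text \<open>Only the integer consequences of the spectral hypothesis are kept; eigenvalues no longer
  occur.\<close>

locale quadratic_laplacian = adjacency +
  fixes s p \<mu> :: int
  assumes mu_pos: "0 < \<mu>" and p_eq: "p = int n * \<mu>"
    and nonadj: "\<exists>i<n. \<exists>j<n. i \<noteq> j \<and> a i j = 0"
    and quad: "i < n \<Longrightarrow> j < n \<Longrightarrow>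
      (\<Sum>k<n. lap i k * lap k j) = s * lap i j - (if i = j then p else 0) + \<mu>"
begin

definition N :: "nat \<Rightarrow> nat \<Rightarrow> int" where
  "N i j = (if i = j then s else 0) - lap i j"

text \<open>Phrased by representatives, to stay free of quotient groups until
  \<open>critical_group_exponent\<close>.\<close>

definition annihilates :: "nat \<Rightarrow> bool" where
  "annihilates k \<longleftrightarrow> (\<forall>x :: nat \<Rightarrow> int.
    (\<exists>m>0. \<exists>y. \<forall>i<n. int m * x i = (\<Sum>j<n. lap i j * y j)) \<longrightarrow>
    (\<exists>z. \<forall>i<n. int k * x i = (\<Sum>j<n. lap i j * z j)))"

text \<open>The pairing of \<open>e_u - e_v\<close> with \<open>N (e_i - e_j)\<close> for unit
  vectors \<open>e\<close>. It does not change when terms \<open>w i + w j\<close> are added to the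
  entries of \<open>N\<close>.\<close>

definition mixed_diff :: "nat \<Rightarrow> nat \<Rightarrow> nat \<Rightarrow> nat \<Rightarrow> int" where
  "mixed_diff u v i j = N u i - N u j - N v i + N v j"

lemma p_pos: "0 < p"
  using mu_pos p_eq nonadj by auto

lemma lap_lap:
  assumes "i < n"
  shows "(\<Sum>l<n. lap i l * (\<Sum>k<n. lap l k * y k)) =
    s * (\<Sum>k<n. lap i k * y k) - p * y i + \<mu> * (\<Sum>k<n. y k)"
proof -
  have "(\<Sum>l<n. lap i l * (\<Sum>k<n. lap l k * y k)) = (\<Sum>l<n. \<Sum>k<n. lap i l * lap l k * y k)"
    by (simp add: sum_distrib_left mult.assoc)
  also have "\<dots> = (\<Sum>k<n. (\<Sum>l<n. lap i l * lap l k) * y k)"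
    by (subst sum.swap) (simp add: sum_distrib_right)
  also have "\<dots> = (\<Sum>k<n. s * (lap i k * y k) - (if k = i then p * y i else 0) + \<mu> * y k)"
    using assms by (intro sum.cong refl) (simp add: quad, simp add: algebra_simps)
  also have "\<dots> = s * (\<Sum>k<n. lap i k * y k) - p * y i + \<mu> * (\<Sum>k<n. y k)"
    using assms by (simp add: sum.distrib sum_subtractf sum_distrib_left)
  finally show ?thesis .
qed

lemma N_apply: "i < n \<Longrightarrow> (\<Sum>k<n. N i k * f k) = s * f i - (\<Sum>k<n. lap i k * f k)"
proof -
  assume "i < n"
  have "(\<Sum>k<n. N i k * f k) = (\<Sum>k<n. (if k = i then s * f i else 0) - lap i k * f k)"
    by (intro sum.cong refl) (auto simp: N_def algebra_simps)
  then show ?thesis using \<open>i < n\<close> by (simp add: sum_subtractf)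
qed

lemma N_lap:
  assumes "i < n"
  shows "(\<Sum>l<n. N i l * (\<Sum>k<n. lap l k * y k)) = p * y i - \<mu> * (\<Sum>k<n. y k)"
  using assms by (simp add: N_apply lap_lap)

lemma lap_N:
  assumes "i < n"
  shows "(\<Sum>l<n. lap i l * (\<Sum>k<n. N l k * y k)) = p * y i - \<mu> * (\<Sum>k<n. y k)"
proof -
  have "(\<Sum>l<n. lap i l * (\<Sum>k<n. N l k * y k)) =
      (\<Sum>l<n. s * (lap i l * y l) - lap i l * (\<Sum>k<n. lap l k * y k))"
    by (intro sum.cong refl) (simp add: N_apply right_diff_distrib mult.left_commute)
  then show ?thesis
    using assms by (simp add: sum_subtractf lap_lap flip: sum_distrib_left)
qed

text \<open>If \<open>k (e_i - e_j) = L z\<close>, applying \<open>N\<close> shows that the entries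
  of \<open>k N (e_i - e_j)\<close> agree modulo \<open>p\<close>. Conversely, such agreement lets
  \<open>k N x\<close> be shifted by a constant and divided by \<open>p\<close>, which yields a
  preimage of \<open>k x\<close>.\<close>

lemma annihilates_iff:
  "annihilates k \<longleftrightarrow> (\<forall>u<n. \<forall>v<n. \<forall>i<n. \<forall>j<n. p dvd int k * mixed_diff u v i j)"
proof (intro iffI allI impI)
  fix u v i j assume ann: "annihilates k" and uv: "u < n" "v < n" and ij: "i < n" "j < n"
  \<comment> \<open>\<open>e_i - e_j\<close> has coordinate sum zero and is torsion, since then
    \<open>L N x = p x\<close>.\<close>
  define x :: "nat \<Rightarrow> int" where "x = (\<lambda>l. (if l = i then 1 else 0) - (if l = j then 1 else 0))"
  have Nx: "(\<Sum>k<n. N l k * x k) = N l i - N l j" for l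
  proof -
    have "(\<Sum>k<n. N l k * x k) = (\<Sum>k<n. (if k = i then N l i else 0) - (if k = j then N l j else 0))"
      by (intro sum.cong refl) (simp add: x_def)
    then show ?thesis using ij by (simp add: sum_subtractf)
  qed
  have "(\<Sum>k<n. x k) = 0" using ij by (simp add: x_def sum_subtractf)
  then have "\<forall>l<n. int (nat p) * x l = (\<Sum>m<n. lap l m * (\<Sum>k<n. N m k * x k))"
    using p_pos by (simp add: lap_N)
  moreover have "nat p > 0" using p_pos by simp
  ultimately obtain z where z: "\<forall>l<n. int k * x l = (\<Sum>m<n. lap l m * z m)"
    using ann unfolding annihilates_def by meson
  have "int k * (N l i - N l j) = p * z l - \<mu> * (\<Sum>m<n. z m)" if "l < n" for l
  proof -
    have "int k * (N l i - N l j) = (\<Sum>m<n. N l m * (int k * x m))"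
      by (simp add: sum_distrib_left algebra_simps flip: Nx)
    also have "\<dots> = (\<Sum>m<n. N l m * (\<Sum>q<n. lap m q * z q))"
      using z by simp
    finally show ?thesis using that by (simp add: N_lap)
  qed
  from this[OF uv(1)] this[OF uv(2)] have "int k * mixed_diff u v i j = p * (z u - z v)"
    by (simp add: mixed_diff_def algebra_simps)
  then show "p dvd int k * mixed_diff u v i j" by simp
next
  assume dv: "\<forall>u<n. \<forall>v<n. \<forall>i<n. \<forall>j<n. p dvd int k * mixed_diff u v i j"
  show "annihilates k"
    unfolding annihilates_def
  proof (intro allI impI)
    fix x :: "nat \<Rightarrow> int"
    assume "\<exists>m>0. \<exists>y. \<forall>i<n. int m * x i = (\<Sum>j<n. lap i j * y j)"
    then obtain m y where "m > 0" and y: "\<forall>i<n. int m * x i = (\<Sum>j<n. lap i j * y j)"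
      by blast
    then have "int m * (\<Sum>i<n. x i) = (\<Sum>i<n. \<Sum>j<n. lap i j * y j)"
      by (simp add: sum_distrib_left)
    then have x0: "(\<Sum>i<n. x i) = 0"
      using lap_col_sum \<open>m > 0\<close> by simp
    have npos: "0 < n" using nonadj by auto
    define w where "w = (\<lambda>l. int k * (\<Sum>i<n. N l i * x i))"
    have "p dvd w l - w 0" if "l < n" for l
    proof -
      \<comment> \<open>As \<open>x\<close> has sum zero, column 0 of \<open>N\<close> may be
        subtracted from every column, which produces mixed differences.\<close>
      have "(\<Sum>i<n. N l i * x i) - (\<Sum>i<n. N 0 i * x i) =
          (\<Sum>i<n. mixed_diff l 0 i 0 * x i) + (N l 0 - N 0 0) * (\<Sum>i<n. x i)"
        unfolding sum_distrib_left sum_subtractf[symmetric] sum.distrib[symmetric]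
        by (intro sum.cong refl) (simp add: mixed_diff_def algebra_simps)
      then have "w l - w 0 = int k * (\<Sum>i<n. mixed_diff l 0 i 0 * x i)"
        by (simp add: w_def x0 flip: right_diff_distrib)
      also have "\<dots> = (\<Sum>i<n. int k * mixed_diff l 0 i 0 * x i)"
        by (simp add: sum_distrib_left mult.assoc)
      also have "p dvd \<dots>"
        by (rule dvd_sum, rule dvd_mult2) (use dv that npos in simp)
      finally show ?thesis .
    qed
    then obtain z where z: "\<And>l. l < n \<Longrightarrow> w l - w 0 = p * z l"
      unfolding dvd_def by metis
    have "int k * x i = (\<Sum>j<n. lap i j * z j)" if "i < n" for i
    proof -
      \<comment> \<open>\<open>L\<close> kills the constant \<open>w 0\<close> and turns
        \<open>k N x\<close> into \<open>k p x\<close>; then \<open>p\<close> cancels.\<close>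
      have "p * (\<Sum>j<n. lap i j * z j) = (\<Sum>j<n. lap i j * (w j - w 0))"
        unfolding sum_distrib_left by (intro sum.cong refl) (simp add: z)
      also have "\<dots> = (\<Sum>j<n. lap i j * w j) - w 0 * (\<Sum>j<n. of_int (lap i j) * 1)"
        by (simp add: sum_distrib_left algebra_simps sum_subtractf)
      also have "(\<Sum>j<n. of_int (lap i j) * (1::int)) = 0"
        using lap_apply[OF that, of "\<lambda>_. 1 :: int"] by simp
      also have "(\<Sum>j<n. lap i j * w j) = int k * (\<Sum>j<n. lap i j * (\<Sum>i<n. N j i * x i))"
        by (simp add: w_def sum_distrib_left mult.left_commute)
      also have "\<dots> = int k * (p * x i)" using that by (simp add: lap_N x0)
      finally show ?thesis using p_pos by simp
    qed
    then show "\<exists>z. \<forall>i<n. int k * x i = (\<Sum>j<n. lap i j * z j)" by blast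
  qed
qed

section \<open>Common divisors of the mixed differences\<close>

lemma common_neighbours:
  assumes "i < n" "j < n" "i \<noteq> j" "a i j = 0"
  shows "(\<Sum>k<n. a i k * a k j) = \<mu>"
  using lap_square[OF assms(1,2)] quad[OF assms(1,2)] assms(3,4) by (simp add: lap_def)

lemma N_entry: "i < n \<Longrightarrow> N i j = (if i = j then s - deg i else a i j)"
  by (simp add: N_def lap_def a_irrefl)

lemma N_offdiag: "i \<noteq> j \<Longrightarrow> N i j = a i j"
  by (simp add: N_def lap_def)

text \<open>
  If \<open>i\<close>, \<open>j\<close> are nonadjacent with common neighbour \<open>l\<close>, the difference at \<open>(k, l; i, j)\<close> is
  \<open>a k i - a k j\<close>, which must vanish. Two adjacent neighbours \<open>v\<close>, \<open>w\<close> of twins \<open>x\<close>, \<open>y\<close> would give the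
  difference \<open>- 1\<close> at \<open>(x, v; y, w)\<close>.
\<close>

lemma bipartite_of_dvd:
  assumes h: "1 < h" "\<And>u v i j. u < n \<Longrightarrow> v < n \<Longrightarrow> i < n \<Longrightarrow> j < n \<Longrightarrow> h dvd mixed_diff u v i j"
  obtains U V where "bipartition U V" "2 \<le> card U" "V \<noteq> {}"
proof -
  have small: "x = 0" if "h dvd x" "\<bar>x\<bar> \<le> 1" for x :: int
    using that h(1) dvd_imp_le_int[of x h] by linarith
  have twins: "a k i = a k j"
    if ij: "i < n" "j < n" "i \<noteq> j" "a i j = 0" and k: "k < n" "k \<noteq> i" "k \<noteq> j" for i j k
  proof -
    have "(\<Sum>l<n. a i l * a l j) \<noteq> 0"
      using common_neighbours[OF ij] mu_pos by simp
    then obtain l where l: "l < n" "a i l * a l j \<noteq> 0"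
      by (auto elim: sum.not_neutral_contains_not_neutral)
    then have l1: "a l i = 1" "a l j = 1" "l \<noteq> i" "l \<noteq> j"
      using a_01[of i l] a_01[of l j] a_sym[of i l] a_irrefl ij by auto
    have "a k i - a k j = mixed_diff k l i j"
      using k l1 by (simp add: mixed_diff_def N_offdiag)
    then have "h dvd a k i - a k j" using h(2) k l ij by simp
    moreover have "\<bar>a k i - a k j\<bar> \<le> 1"
      using a_01[of k i] a_01[of k j] ij k by auto
    ultimately show ?thesis using small[of "a k i - a k j"] by simp
  qed
  obtain x y where xy: "x < n" "y < n" "x \<noteq> y" "a x y = 0" using nonadj by blast
  \<comment> \<open>\<open>x\<close> lies in \<open>U\<close> since \<open>a x x = 0\<close>; every
    other member is nonadjacent to \<open>x\<close>, so \<open>twins\<close> applies to it.\<close>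
  define U where "U = {i. i < n \<and> a x i = 0}"
  define V where "V = {i. i < n \<and> a x i = 1}"
  have U: "a u v = a x v" if "u \<in> U" "v < n" "v \<noteq> x" "v \<noteq> u" for u v
    using that twins[of x u v] a_sym[of v u] a_sym[of v x] xy(1) unfolding U_def
    by (cases "u = x") auto
  have xU: "x \<in> U" "y \<in> U" using xy a_irrefl by (auto simp: U_def)
  have V: "a v w = 0" if vw: "v \<in> V" "w \<in> V" for v w
  proof (rule ccontr)
    assume "a v w \<noteq> 0"
    then have 1: "a v w = 1" "v \<noteq> w" using a_01 a_irrefl vw by (auto simp: V_def)
    have neq: "v \<noteq> x" "w \<noteq> x" "v \<noteq> y" "w \<noteq> y" using vw xU xy by (auto simp: U_def V_def)
    have "a x w = 1" "a y v = 1" "v < n" "w < n"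
      using vw neq U[OF xU(2), of v] by (auto simp: V_def)
    then have "mixed_diff x v y w = - 1"
      using neq xy 1 by (simp add: mixed_diff_def N_offdiag a_sym[of v y])
    with h(2)[of x v y w] small[of "-1"] \<open>v < n\<close> \<open>w < n\<close> xy show False by simp
  qed
  have "bipartition U V"
    unfolding bipartition_def
  proof (intro conjI allI impI)
    show "U \<union> V = {..<n}" using a_01[OF xy(1)] by (auto simp: U_def V_def)
    show "U \<inter> V = {}" by (auto simp: U_def V_def)
    fix i j assume ij: "i < n" "j < n"
    have UU: "a i j = 0" if ij: "i \<in> U" "j \<in> U" for i j
    proof -
      have lt: "i < n" "j < n" "a x i = 0" "a x j = 0" using ij by (simp_all add: U_def)
      consider "i = j" | "j = x" | "j \<noteq> i" "j \<noteq> x" by blast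
      then show ?thesis
      proof cases
        case 1
        with lt show ?thesis by (simp add: a_irrefl)
      next
        case 2
        with lt a_sym[of i x] show ?thesis by simp
      next
        case 3
        with U[OF ij(1) lt(2)] lt show ?thesis by simp
      qed
    qed
    have UV: "a i j = 1" if "i \<in> U" "j \<in> V" for i j
    proof -
      have "j < n" "a x j = 1" "j \<noteq> x" "j \<noteq> i"
        using that a_irrefl by (auto simp: U_def V_def)
      then show ?thesis using U[OF that(1)] by simp
    qed
    have mem: "k \<in> V \<longleftrightarrow> k \<notin> U" if "k < n" for k
      using a_01[OF xy(1) that] that by (auto simp: U_def V_def)
    show "(a i j = 1) = ((i, j) \<in> U \<times> V \<union> V \<times> U)"
    proof (cases "i \<in> U"; cases "j \<in> U")
      assume "i \<notin> U" "j \<in> U"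
      then show ?thesis using UV[of j i] a_sym[OF ij] mem ij by simp
    qed (use UU[of i j] UV[of i j] V[of i j] mem ij in simp_all)
  qed
  moreover have "2 \<le> card U"
    using card_mono[of U "{x, y}"] xU xy(3) by (simp add: U_def)
  moreover have "V \<noteq> {}"
  proof
    assume "V = {}"
    then have "a x k = 0" if "k < n" for k
      using a_01[OF xy(1) that] that by (auto simp: V_def)
    then show False using common_neighbours[OF xy] mu_pos by simp
  qed
  ultimately show thesis by (rule that)
qed

section \<open>Parameters of a complete bipartite graph\<close>

lemma bipartition_swap: "bipartition U V \<Longrightarrow> bipartition V U"
  unfolding bipartition_def by blast

context
  fixes U V
  assumes bip: "bipartition U V"
begin

lemma bip_finite: "finite U" "finite V" "U \<subseteq> {..<n}" "V \<subseteq> {..<n}"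
proof -
  show "U \<subseteq> {..<n}" "V \<subseteq> {..<n}" using bip by (auto simp: bipartition_def)
  then show "finite U" "finite V" using finite_subset by blast+
qed

lemma bip_card: "n = card U + card V"
  using bip bip_finite card_Un_disjoint[of U V] by (simp add: bipartition_def)

lemma bip_a: "i < n \<Longrightarrow> j < n \<Longrightarrow> a i j = of_bool (i \<in> U \<longleftrightarrow> j \<in> V)"
  using bip a_01[of i j] unfolding bipartition_def by auto

lemma bip_deg: "i \<in> U \<Longrightarrow> deg i = int (card V)"
proof -
  assume "i \<in> U"
  then have "deg i = (\<Sum>k<n. of_bool (k \<in> V))"
    using bip_finite unfolding deg_def by (intro sum.cong refl) (auto simp: bip_a)
  also have "\<dots> = int (card V)"
    using bip_finite by (simp add: Int_absorb1)
  finally show ?thesis .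
qed

text \<open>Two vertices on one side have exactly the opposite side as common neighbours.\<close>

lemma bip_mu: "2 \<le> card U \<Longrightarrow> \<mu> = int (card V)"
proof -
  assume "2 \<le> card U"
  then obtain u v where uv: "u \<in> U" "v \<in> U" "u \<noteq> v"
    using card_le_Suc0_iff_eq[OF bip_finite(1)] by fastforce
  then have lt: "u < n" "v < n" using bip_finite by auto
  have nV: "u \<notin> V" "v \<notin> V" using uv bip by (auto simp: bipartition_def)
  have "\<mu> = (\<Sum>k<n. a u k * a k v)"
    using common_neighbours[of u v] uv lt nV by (simp add: bip_a)
  also have "\<dots> = (\<Sum>k<n. a u k)"
    using lt uv nV bip by (intro sum.cong refl) (auto simp: bip_a bipartition_def)
  finally show ?thesis using bip_deg[OF uv(1)] by (simp add: deg_def)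
qed

text \<open>An edge lies in no triangle, so the entry of \<open>L^2\<close> there is minus the sum
  of the end degrees; \<open>quad\<close> then determines \<open>s\<close>.\<close>

lemma bip_s:
  assumes "U \<noteq> {}" "V \<noteq> {}"
  shows "s = \<mu> + int n"
proof -
  obtain u v where uv: "u \<in> U" "v \<in> V" using assms by blast
  then have lt: "u < n" "v < n" using bip_finite by auto
  have *: "u \<noteq> v" "u \<notin> V" "v \<notin> U" using uv bip by (auto simp: bipartition_def)
  have deg_v: "deg v = int (card U)"
    using quadratic_laplacian.bip_deg[OF quadratic_laplacian_axioms bipartition_swap[OF bip] uv(2)] .
  have "(\<Sum>k<n. a u k * a k v) = 0"
    using lt uv * bip by (intro sum.neutral) (auto simp: bip_a bipartition_def)
  then have "- (deg u + deg v) = - s + \<mu>"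
    using lap_square[OF lt] quad[OF lt] * uv lt by (simp add: lap_def bip_a)
  then show ?thesis
    using bip_deg[OF uv(1)] deg_v bip_card by simp
qed

end

text \<open>The cofactor \<open>h\<close> of \<open>gcd p k\<close> in \<open>p\<close> divides all
  mixed differences. If \<open>h > 1\<close>, the graph is complete bipartite; computing
  \<open>\<mu>\<close> from both sides gives equal sides unless one is a single vertex, and both
  outcomes are excluded.\<close>

lemma annihilates_dvd:
  assumes ann: "annihilates k"
    and no_Kmm: "\<And>U V. bipartition U V \<Longrightarrow> 2 \<le> card U \<Longrightarrow> card U \<noteq> card V"
    and no_star: "\<And>U V. bipartition U V \<Longrightarrow> card U = 1 \<Longrightarrow> card V < 2"
  shows "p dvd int k"
proof -
  define g where "g = gcd p (int k)"
  have g: "0 < g" using p_pos by (simp add: g_def)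
  then obtain h k' where h: "p = h * g" "int k = k' * g" "coprime h k'"
    using gcd_coprime_exists[of p "int k"] unfolding g_def by auto
  have h_dvd: "h dvd mixed_diff u v i j" if "u < n" "v < n" "i < n" "j < n" for u v i j
  proof -
    have "p dvd int k * mixed_diff u v i j"
      using ann that by (simp add: annihilates_iff)
    then have "g * h dvd g * (k' * mixed_diff u v i j)"
      by (simp only: h ac_simps)
    then have "h dvd k' * mixed_diff u v i j"
      using g by simp
    then show ?thesis using h(3) by (simp add: coprime_dvd_mult_right_iff)
  qed
  have "0 < h" using p_pos g unfolding h(1) by (simp add: zero_less_mult_iff)
  have "\<not> 1 < h"
  proof
    assume "1 < h"
    then obtain U V where bip: "bipartition U V" and U: "2 \<le> card U" and "V \<noteq> {}"
      by (rule bipartite_of_dvd[where h = h]) (use h_dvd in auto)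
    then have V: "0 < card V" using bip_finite[OF bip] by (simp add: card_gt_0_iff)
    show False
    proof (cases "card V = 1")
      case True
      then show False using no_star[OF bipartition_swap[OF bip]] U by simp
    next
      case False
      then have "\<mu> = int (card U)"
        using bip_mu[OF bipartition_swap[OF bip]] V by simp
      then show False using bip_mu[OF bip U] no_Kmm[OF bip U] by simp
    qed
  qed
  with \<open>0 < h\<close> have "h = 1" by simp
  then show ?thesis by (simp add: h)
qed

lemma annihilates_p: "annihilates (nat p)"
  using p_pos by (simp add: annihilates_iff)

text \<open>The terms \<open>w i + w j\<close> cancel, so \<open>N\<close> matters only modulo
  \<open>h\<close> and up to such terms.\<close>

lemma mixed_diff_dvd:
  assumes "\<And>i j. i < n \<Longrightarrow> j < n \<Longrightarrow> h dvd N i j - (w i + w j)"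
    and "u < n" "v < n" "i < n" "j < n"
  shows "h dvd mixed_diff u v i j"
proof -
  have "mixed_diff u v i j = (N u i - (w u + w i)) - (N u j - (w u + w j))
      - (N v i - (w v + w i)) + (N v j - (w v + w j))"
    by (simp add: mixed_diff_def)
  also have "h dvd \<dots>"
    by (rule dvd_add[OF dvd_diff[OF dvd_diff]]; intro assms)
  finally show ?thesis .
qed

text \<open>Modulo 2, \<open>N\<close> is \<open>w i + w j\<close> with \<open>w\<close> the
  indicator of \<open>U\<close>, so all mixed differences are even, and one of them is -2. Hence
  \<open>p = 2 m^2\<close> divides all of them times \<open>k\<close> exactly when
  \<open>m^2\<close> divides \<open>k\<close>.\<close>

lemma Kmm_exponent:
  assumes bip: "bipartition U V" and m: "card U = m" "card V = m" "2 \<le> m"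
  shows "p = 2 * (int m)\<^sup>2" and "annihilates k \<longleftrightarrow> m\<^sup>2 dvd k"
proof -
  note bip' = bipartition_swap[OF bip]
  have mu: "\<mu> = int m" using bip_mu[OF bip] m by simp
  have n: "n = 2 * m" using bip_card[OF bip] m by simp
  show p: "p = 2 * (int m)\<^sup>2" by (simp add: p_eq mu n power2_eq_square)
  have ne: "U \<noteq> {}" "V \<noteq> {}" using m by auto
  have s: "s = 3 * int m" using bip_s[OF bip ne] mu n by simp
  define w where "w = (\<lambda>i. of_bool (i \<in> U) :: int)"
  have UV: "i \<in> V \<longleftrightarrow> i \<notin> U" if "i < n" for i
    using bip that by (auto simp: bipartition_def)
  have deg: "deg i = int m" if "i < n" for i
    using bip_deg[OF bip, of i] bip_deg[OF bip', of i] UV that m by auto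
  have N: "N i j = (if i = j then 2 * int m else of_bool (i \<in> U \<longleftrightarrow> j \<notin> U))" if "i < n" "j < n" for i j
    unfolding N_entry[OF that(1)] using that UV[OF that(2)] by (simp add: s deg bip_a[OF bip])
  have even: "2 dvd mixed_diff u v i j" if "u < n" "v < n" "i < n" "j < n" for u v i j
    using that by (intro mixed_diff_dvd[where w = w]) (auto simp: N w_def)
  obtain x y where xy: "x \<in> U" "y \<in> U" "x \<noteq> y"
    using card_le_Suc0_iff_eq[OF bip_finite(1)[OF bip]] m by fastforce
  obtain x' y' where xy': "x' \<in> V" "y' \<in> V" "x' \<noteq> y'"
    using card_le_Suc0_iff_eq[OF bip_finite(2)[OF bip]] m by fastforce
  have lt: "x < n" "y < n" "x' < n" "y' < n"
    using xy xy' bip_finite(3,4)[OF bip] by auto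
  have two: "mixed_diff x x' y y' = - 2"
    using xy xy' lt UV by (auto simp: mixed_diff_def N)
  show "annihilates k \<longleftrightarrow> m\<^sup>2 dvd k"
  proof
    assume "annihilates k"
    then have "p dvd int k * mixed_diff x x' y y'" using lt by (simp add: annihilates_iff)
    then have "2 * (int m)\<^sup>2 dvd 2 * int k" by (simp add: two p mult.commute)
    then have "int (m\<^sup>2) dvd int k" by simp
    then show "m\<^sup>2 dvd k" by (simp only: int_dvd_int_iff)
  next
    assume "m\<^sup>2 dvd k"
    then have "int (m\<^sup>2) dvd int k" by (simp only: int_dvd_int_iff)
    then have "(int m)\<^sup>2 dvd int k" by simp
    then have "(int m)\<^sup>2 * 2 dvd int k * mixed_diff u v i j"
      if "u < n" "v < n" "i < n" "j < n" for u v i j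
      using even[OF that] by (rule mult_dvd_mono)
    then show "annihilates k"
      unfolding annihilates_iff p by (simp only: mult.commute[of 2]) blast
  qed
qed

text \<open>With \<open>w\<close> the indicator of the centre, \<open>N\<close> differs from
  \<open>w i + w j\<close> only by \<open>p\<close> on the diagonal at the leaves. So
  \<open>p\<close> divides every mixed difference, and the torsion is trivial.\<close>

lemma star_exponent:
  assumes bip: "bipartition U V" and "card U = 1" "card V = q" "2 \<le> q"
  shows "p = int q + 1" and "annihilates 1"
proof -
  note bip' = bipartition_swap[OF bip]
  have mu: "\<mu> = 1" using bip_mu[OF bip'] assms by simp
  have n: "n = q + 1" using bip_card[OF bip] assms by simp
  show p: "p = int q + 1" by (simp add: p_eq mu n)
  have ne: "U \<noteq> {}" "V \<noteq> {}" using assms by auto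
  have s: "s = int q + 2" using bip_s[OF bip ne] mu n by simp
  have UV: "i \<in> V \<longleftrightarrow> i \<notin> U" if "i < n" for i
    using bip that by (auto simp: bipartition_def)
  have U1: "i = j" if "i \<in> U" "j \<in> U" for i j
    using assms(2) that by (auto simp: card_1_singleton_iff)
  define w where "w = (\<lambda>i. of_bool (i \<in> U) :: int)"
  have deg: "deg i = (if i \<in> U then int q else 1)" if "i < n" for i
    using bip_deg[OF bip, of i] bip_deg[OF bip', of i] UV that assms by auto
  have N: "N i j - (w i + w j) = (if i = j \<and> i \<notin> U then p else 0)" if "i < n" "j < n" for i j
    unfolding N_entry[OF that(1)]
    using that UV[OF that(2)] U1[of i j] by (auto simp: s deg p w_def bip_a[OF bip])
  have "p dvd mixed_diff u v i j" if "u < n" "v < n" "i < n" "j < n" for u v i j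
    using that by (intro mixed_diff_dvd[where w = w]) (simp_all add: N)
  then show "annihilates 1" by (simp add: annihilates_iff)
qed

end

section \<open>The critical group\<close>

lemma monoid_vec_pow:
  assumes "x \<in> carrier_vec m"
  shows "x [^]\<^bsub>monoid_vec TYPE(int) m\<^esub> (k::nat) = int k \<cdot>\<^sub>v x"
proof (induction k)
  case 0
  then show ?case using assms by (auto simp: monoid_vec_simps)
next
  case (Suc k)
  then show ?case using assms by (auto simp: monoid_vec_simps algebra_simps)
qed

lemma image_normal:
  fixes A :: "int mat"
  assumes A: "A \<in> carrier_mat m l"
  shows "(\<lambda>x. A *\<^sub>v x) ` carrier_vec l \<lhd> monoid_vec TYPE(int) m"
proof -
  interpret comm_group "monoid_vec TYPE(int) m" by (rule comm_group_vec)
  have "subgroup ((\<lambda>x. A *\<^sub>v x) ` carrier_vec l) (monoid_vec TYPE(int) m)"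
  proof (rule subgroupI)
    show "(\<lambda>x. A *\<^sub>v x) ` carrier_vec l \<subseteq> carrier (monoid_vec TYPE(int) m)"
      using A by (auto simp: monoid_vec_simps)
    show "(\<lambda>x. A *\<^sub>v x) ` carrier_vec l \<noteq> {}"
      by (auto intro: zero_carrier_vec)
    show "inv\<^bsub>monoid_vec TYPE(int) m\<^esub> u \<in> (\<lambda>x. A *\<^sub>v x) ` carrier_vec l"
      if u: "u \<in> (\<lambda>x. A *\<^sub>v x) ` carrier_vec l" for u
    proof -
      obtain x where x: "x \<in> carrier_vec l" "u = A *\<^sub>v x" using u by blast
      have "A *\<^sub>v (- x) + A *\<^sub>v x = A *\<^sub>v (- x + x)"
        using A x by (intro mult_add_distrib_mat_vec[symmetric]) auto
      also have "\<dots> = 0\<^sub>v m" using A x by auto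
      finally have "inv\<^bsub>monoid_vec TYPE(int) m\<^esub> u = A *\<^sub>v (- x)"
        using A x by (intro inv_equality) (auto simp: monoid_vec_simps)
      then show ?thesis using x by auto
    qed
    show "u \<otimes>\<^bsub>monoid_vec TYPE(int) m\<^esub> v \<in> (\<lambda>x. A *\<^sub>v x) ` carrier_vec l"
      if u: "u \<in> (\<lambda>x. A *\<^sub>v x) ` carrier_vec l" and v: "v \<in> (\<lambda>x. A *\<^sub>v x) ` carrier_vec l" for u v
    proof -
      obtain x y where "x \<in> carrier_vec l" "u = A *\<^sub>v x" "y \<in> carrier_vec l" "v = A *\<^sub>v y"
        using u v by blast
      then show ?thesis
        using A by (auto simp: monoid_vec_simps image_iff
            intro!: bexI[of _ "x + y"] mult_add_distrib_mat_vec[symmetric])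
    qed
  qed
  then show ?thesis by (rule subgroup_imp_normal)
qed

text \<open>A multiple of a coset is trivial iff the same multiple of a representative lies in the
  image.\<close>

lemma group_exponent_torsion_cokernel:
  fixes A :: "int mat"
  assumes A: "A \<in> carrier_mat m l"
  shows "group_exponent (torsion_part (cokernel A)) =
    (LEAST k. 0 < k \<and> (\<forall>x\<in>carrier_vec m. (\<exists>j>0. \<exists>y\<in>carrier_vec l. int j \<cdot>\<^sub>v x = A *\<^sub>v y)
      \<longrightarrow> (\<exists>y\<in>carrier_vec l. int k \<cdot>\<^sub>v x = A *\<^sub>v y)))"
proof -
  define H where "H = (\<lambda>x. A *\<^sub>v x) ` carrier_vec l"
  let ?Z = "monoid_vec TYPE(int) m"
  interpret Z: comm_group ?Z by (rule comm_group_vec)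
  interpret H: normal H ?Z
    unfolding H_def using A by (rule image_normal)
  have coker: "cokernel A = ?Z Mod H"
    using A by (simp add: cokernel_def H_def)
  have one: "\<one>\<^bsub>?Z Mod H\<^esub> = H" by (simp add: FactGroup_def)
  have pow: "(H #>\<^bsub>?Z\<^esub> x) [^]\<^bsub>?Z Mod H\<^esub> k = \<one>\<^bsub>?Z Mod H\<^esub> \<longleftrightarrow>
      (\<exists>y\<in>carrier_vec l. int k \<cdot>\<^sub>v x = A *\<^sub>v y)" if x: "x \<in> carrier_vec m" for x and k :: nat
  proof -
    have "x \<in> carrier ?Z" using x by (simp add: monoid_vec_simps)
    then have "(H #>\<^bsub>?Z\<^esub> x) [^]\<^bsub>?Z Mod H\<^esub> k = H #>\<^bsub>?Z\<^esub> (int k \<cdot>\<^sub>v x)"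
      using monoid_vec_pow[OF x] H.FactGroup_pow by metis
    moreover have "int k \<cdot>\<^sub>v x \<in> carrier ?Z" using x by (simp add: monoid_vec_simps)
    then have "H #>\<^bsub>?Z\<^esub> (int k \<cdot>\<^sub>v x) = H \<longleftrightarrow> int k \<cdot>\<^sub>v x \<in> H"
      using Z.coset_join1 Z.coset_join2 H.subgroup_axioms by metis
    ultimately show ?thesis unfolding one by (auto simp: H_def)
  qed
  \<comment> \<open>\<open>torsion_part\<close> changes only the carrier.\<close>
  have tpow: "x [^]\<^bsub>torsion_part K\<^esub> k = x [^]\<^bsub>K\<^esub> k" "\<one>\<^bsub>torsion_part K\<^esub> = \<one>\<^bsub>K\<^esub>"
    for x and k :: nat and K :: "int vec set monoid"
    by (induction k) (simp_all add: torsion_part_def)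
  have carr: "carrier (torsion_part (?Z Mod H)) = (\<lambda>x. H #>\<^bsub>?Z\<^esub> x) ` {x \<in> carrier_vec m.
      \<exists>j>0. \<exists>y\<in>carrier_vec l. int j \<cdot>\<^sub>v x = A *\<^sub>v y}"
  proof -
    have "{x \<in> carrier_vec m. \<exists>j>0. \<exists>y\<in>carrier_vec l. int j \<cdot>\<^sub>v x = A *\<^sub>v y} =
        {x \<in> carrier_vec m. \<exists>j::nat. 0 < j \<and> (H #>\<^bsub>?Z\<^esub> x) [^]\<^bsub>?Z Mod H\<^esub> j = \<one>\<^bsub>?Z Mod H\<^esub>}"
      using pow by blast
    then show ?thesis
      by (auto simp: torsion_part_def carrier_FactGroup monoid_vec_simps)
  qed
  have "(\<forall>X\<in>carrier (torsion_part (cokernel A)). X [^]\<^bsub>torsion_part (cokernel A)\<^esub> k =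
      \<one>\<^bsub>torsion_part (cokernel A)\<^esub>) \<longleftrightarrow>
      (\<forall>x\<in>carrier_vec m. (\<exists>j>0. \<exists>y\<in>carrier_vec l. int j \<cdot>\<^sub>v x = A *\<^sub>v y)
      \<longrightarrow> (\<exists>y\<in>carrier_vec l. int k \<cdot>\<^sub>v x = A *\<^sub>v y))" for k :: nat
    unfolding coker tpow carr using pow by (simp add: ball_simps) blast
  then show ?thesis unfolding group_exponent_def by presburger
qed

section \<open>From digraphs to integer matrices\<close>

definition adj_entry :: "(nat, 'b) pre_digraph \<Rightarrow> nat \<Rightarrow> nat \<Rightarrow> int" where
  "adj_entry G i j = (if (i, j) \<in> arcs_ends G then 1 else 0)"

lemma adjacency_adj:
  assumes "graph G"
  shows "adjacency n (adj_entry G)"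
proof -
  interpret graph G by fact
  show ?thesis
    using sym_arcs no_loops
    by unfold_locales (auto simp: adj_entry_def symmetric_def arcs_ends_conv dest: symD)
qed

text \<open>Without multiple arcs, an arc leaving \<open>i\<close> is determined by its
  head.\<close>

lemma out_degree_eq_sum:
  assumes "graph G" "verts G = {..<n}"
  shows "int (out_degree G i) = (\<Sum>k<n. adj_entry G i k)"
proof -
  interpret graph G by fact
  have "inj_on (head G) (out_arcs G i)"
    using no_multi_arcs by (auto simp: inj_on_def arc_to_ends_def)
  then have "out_degree G i = card (head G ` out_arcs G i)"
    by (simp add: out_degree_def card_image)
  also have "head G ` out_arcs G i = {k \<in> {..<n}. (i, k) \<in> arcs_ends G}"
    using assms(2) head_in_verts by (auto simp: arcs_ends_conv)
  finally show ?thesis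
    by (simp add: adj_entry_def sum.If_cases Int_def conj_commute)
qed

lemma laplacian_index:
  assumes "graph G" "verts G = {..<n}" "i < n" "j < n"
  shows "laplacian n G $$ (i, j) = adjacency.lap n (adj_entry G) i j"
proof -
  interpret adjacency n "adj_entry G" using assms(1) by (rule adjacency_adj)
  show ?thesis
    using assms(3,4) out_degree_eq_sum[OF assms(1,2)]
    by (simp add: laplacian_def degree_matrix_def adjacency_matrix_def lap_def deg_def)
      (simp add: adj_entry_def)
qed

lemma laplacian_carrier: "laplacian n G \<in> carrier_mat n n"
  by (simp add: laplacian_def degree_matrix_def adjacency_matrix_def minus_carrier_mat)

text \<open>The real case serves the eigenvalues; the integer case, where \<open>of_int\<close> is
  the identity, serves the critical group.\<close>

lemma map_laplacian_mult:
  fixes f :: "nat \<Rightarrow> 'r::comm_ring_1"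
  assumes "graph G" "verts G = {..<n}" "i < n"
  shows "(map_mat of_int (laplacian n G) *\<^sub>v vec n f) $ i =
    (\<Sum>k<n. of_int (adjacency.lap n (adj_entry G) i k) * f k)"
  using assms laplacian_carrier[of n G]
  by (auto simp: scalar_prod_def atLeast0LessThan laplacian_index intro!: sum.cong)

lemma eigenvalue_laplacian:
  assumes "graph G" "verts G = {..<n}"
  shows "eigenvalue (map_mat real_of_int (laplacian n G)) e \<longleftrightarrow> adjacency.is_ev n (adj_entry G) e"
proof -
  interpret adjacency n "adj_entry G" using assms(1) by (rule adjacency_adj)
  have dim: "dim_row (map_mat real_of_int (laplacian n G)) = n"
    using laplacian_carrier[of n G] by simp
  have *: "eigenvector (map_mat real_of_int (laplacian n G)) (vec n f) e \<longleftrightarrow>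
      (\<exists>i<n. f i \<noteq> 0) \<and> (\<forall>j<n. (\<Sum>k<n. real_of_int (lap j k) * f k) = e * f j)" for f
    using map_laplacian_mult[OF assms, where f = f] dim
    by (auto simp: eigenvector_def vec_eq_iff)
  show ?thesis
  proof
    assume "eigenvalue (map_mat real_of_int (laplacian n G)) e"
    then obtain v where v: "eigenvector (map_mat real_of_int (laplacian n G)) v e"
      by (auto simp: eigenvalue_def)
    then have "vec n (\<lambda>i. v $ i) = v"
      using dim by (auto simp: eigenvector_def)
    with v show "is_ev e" using *[of "\<lambda>i. v $ i"] by (auto simp: is_ev_def)
  next
    assume "is_ev e"
    then show "eigenvalue (map_mat real_of_int (laplacian n G)) e"
      using * unfolding is_ev_def eigenvalue_def by blast
  qed
qed

text \<open>Induction along a path of the symmetrised digraph, whose steps follow arcs in either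
  direction.\<close>

lemma connected_constant:
  assumes "graph G" "verts G = {..<n}" "Digraph_Component.connected G"
    and f: "\<And>i j. i < n \<Longrightarrow> j < n \<Longrightarrow> adj_entry G i j = 1 \<Longrightarrow> f i = f j"
    and "i < n" "j < n"
  shows "f i = f j"
proof -
  interpret graph G by fact
  have "i \<rightarrow>\<^sup>*\<^bsub>with_proj (mk_symmetric G)\<^esub> j"
    using assms unfolding connected_def strongly_connected_def by simp
  then have "(i, j) \<in> rtrancl_on {..<n} (arcs_ends (with_proj (mk_symmetric G)))"
    using assms(2) by (simp add: reachable_def)
  then show ?thesis
  proof (induction rule: rtrancl_on_induct)
    case (step y z)
    then have "(y, z) \<in> arcs_ends G \<or> (z, y) \<in> arcs_ends G"
      by (auto simp: parcs_mk_symmetric arcs_ends_conv)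
    then have "f y = f z"
      using f[of y z] f[of z y] step by (auto simp: adj_entry_def)
    with step show ?case by simp
  qed simp
qed

text \<open>\<open>bipartition\<close> tests only indices below \<open>n\<close>; this determines
  all of \<open>arcs_ends G\<close> because arcs join vertices.\<close>

lemma bipartition_iff:
  assumes "graph G" "verts G = {..<n}"
  shows "K\<^bsub>m,q\<^esub> G \<longleftrightarrow> (\<exists>U V. adjacency.bipartition n (adj_entry G) U V \<and> card U = m \<and> card V = q)"
proof -
  interpret graph G by fact
  interpret adjacency n "adj_entry G" using assms(1) by (rule adjacency_adj)
  have sub: "arcs_ends G \<subseteq> {..<n} \<times> {..<n}"
    unfolding arcs_ends_conv assms(2)[symmetric] by (intro image_subsetI SigmaI wellformed)
  have adj_1: "adj_entry G i j = 1 \<longleftrightarrow> (i, j) \<in> arcs_ends G" for i j by (simp add: adj_entry_def)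
  show ?thesis
  proof
    assume "K\<^bsub>m,q\<^esub> G"
    then obtain U V where "{..<n} = U \<union> V" "U \<inter> V = {}" "card U = m" "card V = q"
      and arcs: "arcs_ends G = U \<times> V \<union> V \<times> U"
      unfolding complete_bipartite_digraph_def assms(2) by blast
    then have "bipartition U V \<and> card U = m \<and> card V = q"
      unfolding bipartition_def adj_1 arcs by (intro conjI allI impI refl) simp_all
    then show "\<exists>U V. bipartition U V \<and> card U = m \<and> card V = q" by blast
  next
    assume "\<exists>U V. bipartition U V \<and> card U = m \<and> card V = q"
    then obtain U V where UV: "U \<union> V = {..<n}" "U \<inter> V = {}" "card U = m" "card V = q"
      and arcs: "\<And>i j. i < n \<Longrightarrow> j < n \<Longrightarrow> (i, j) \<in> arcs_ends G \<longleftrightarrow> (i, j) \<in> U \<times> V \<union> V \<times> U"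
      unfolding bipartition_def adj_1 by blast
    have mem: "z \<in> arcs_ends G \<longleftrightarrow> z \<in> U \<times> V \<union> V \<times> U" for z
    proof (cases z)
      case (Pair i j)
      have "i < n \<and> j < n" if "(i, j) \<in> U \<times> V \<union> V \<times> U \<or> (i, j) \<in> arcs_ends G"
        using that sub UV(1) by blast
      then show ?thesis unfolding Pair using arcs[of i j] by argo
    qed
    have "arcs_ends G = U \<times> V \<union> V \<times> U" by (rule Set.set_eqI) (rule mem)
    then have "{..<n} = U \<union> V \<and> U \<inter> V = {} \<and> card U = m \<and> card V = q
        \<and> arcs_ends G = U \<times> V \<union> V \<times> U"
      by (simp add: UV)
    then have "\<exists>U V. {..<n} = U \<union> V \<and> U \<inter> V = {} \<and> card U = m \<and> card V = q
        \<and> arcs_ends G = U \<times> V \<union> V \<times> U"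
      by blast
    with assms(1) show "K\<^bsub>m,q\<^esub> G"
      unfolding complete_bipartite_digraph_def assms(2) by (rule conjI)
  qed
qed

lemma critical_group_exponent:
  assumes "graph G" "verts G = {..<n}" "quadratic_laplacian n (adj_entry G) s p \<mu>"
  shows "group_exponent (critical_group n G) =
    (LEAST k. 0 < k \<and> quadratic_laplacian.annihilates n (adj_entry G) k)"
proof -
  interpret quadratic_laplacian n "adj_entry G" s p \<mu> by fact
  have mult: "(laplacian n G *\<^sub>v vec n f) $ i = (\<Sum>k<n. lap i k * f k)" if "i < n" for i f
  proof -
    have "map_mat of_int (laplacian n G) = laplacian n G" by (intro eq_matI) auto
    then show ?thesis using map_laplacian_mult[OF assms(1,2) that, where f = f] by simp
  qed
  have dim: "dim_row (laplacian n G) = n" using laplacian_carrier[of n G] by simp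
  have eq: "int k \<cdot>\<^sub>v vec n x = laplacian n G *\<^sub>v vec n y \<longleftrightarrow>
      (\<forall>i<n. int k * x i = (\<Sum>j<n. lap i j * y j))" for k x y
    using dim by (auto simp: vec_eq_iff mult simp del: index_mult_mat_vec)
  \<comment> \<open>Vectors of dimension \<open>n\<close> are traded for functions, whose values
    from \<open>n\<close> on are irrelevant.\<close>
  have vecs: "(\<forall>v\<in>carrier_vec n. P v) \<longleftrightarrow> (\<forall>f. P (vec n f))"
      "(\<exists>v\<in>carrier_vec n. P v) \<longleftrightarrow> (\<exists>f. P (vec n f))" for P :: "int vec \<Rightarrow> bool"
  proof -
    have "carrier_vec n = range (vec n :: (nat \<Rightarrow> int) \<Rightarrow> int vec)"
    proof (intro equalityI subsetI)
      fix v :: "int vec" assume "v \<in> carrier_vec n"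
      then have "v = vec n (\<lambda>i. v $ i)" by auto
      then show "v \<in> range (vec n)" by blast
    qed auto
    then show "(\<forall>v\<in>carrier_vec n. P v) \<longleftrightarrow> (\<forall>f. P (vec n f))"
      "(\<exists>v\<in>carrier_vec n. P v) \<longleftrightarrow> (\<exists>f. P (vec n f))" by simp_all
  qed
  show ?thesis
    unfolding critical_group_def group_exponent_torsion_cokernel[OF laplacian_carrier]
      vecs eq annihilates_def ..
qed

theorem theorem1p2:
  fixes G :: "(nat, 'b) pre_digraph" and n :: nat and \<theta>\<^sub>1 \<theta>\<^sub>2 :: real
  assumes "graph G" and "verts G = {..<n}" and "Digraph_Component.connected G"
    and "\<theta>\<^sub>1 \<noteq> \<theta>\<^sub>2"
    and "{\<theta>. eigenvalue (map_mat real_of_int (laplacian n G)) \<theta> \<and> \<theta> \<noteq> 0} = {\<theta>\<^sub>1, \<theta>\<^sub>2}"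
  shows "((\<nexists>m. m \<ge> 2 \<and> K\<^bsub>m,m\<^esub> G) \<and> (\<nexists>p. p \<ge> 2 \<and> K\<^bsub>1,p\<^esub> G) \<longrightarrow>
           real (group_exponent (critical_group n G)) = \<theta>\<^sub>1 * \<theta>\<^sub>2) \<and>
         (\<forall>m\<ge>2. K\<^bsub>m,m\<^esub> G \<longrightarrow>
           real (group_exponent (critical_group n G)) = \<theta>\<^sub>1 * \<theta>\<^sub>2 / 2) \<and>
         (\<forall>p\<ge>2. K\<^bsub>1,p\<^esub> G \<longrightarrow>
           real (group_exponent (critical_group n G)) = \<theta>\<^sub>1 * \<theta>\<^sub>2 / (real p + 1))"
proof -
  interpret adjacency n "adj_entry G" using assms(1) by (rule adjacency_adj)
  interpret two_eigenvalues n "adj_entry G" \<theta>\<^sub>1 \<theta>\<^sub>2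
  proof
    show "f i = f j" if "\<And>i j. i < n \<Longrightarrow> j < n \<Longrightarrow> adj_entry G i j = 1 \<Longrightarrow> f i = f j" "i < n" "j < n"
      for f :: "nat \<Rightarrow> real" and i j
      using assms(1-3) that by (rule connected_constant)
    show "is_ev e \<and> e \<noteq> 0 \<longleftrightarrow> e = \<theta>\<^sub>1 \<or> e = \<theta>\<^sub>2" for e
      using assms(5) eigenvalue_laplacian[OF assms(1,2)] by auto
  qed fact
  obtain s p \<mu> where sp: "0 < \<mu>" "p = int n * \<mu>" and p: "real_of_int p = \<theta>\<^sub>1 * \<theta>\<^sub>2"
    and quad: "\<forall>i<n. \<forall>j<n.
      (\<Sum>k<n. lap i k * lap k j) = s * lap i j - (if i = j then p else 0) + \<mu>"
    using lap_quadratic .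
  interpret quadratic_laplacian n "adj_entry G" s p \<mu>
    using sp quad nonadjacent_pair by unfold_locales auto
  note K = bipartition_iff[OF assms(1,2)]
  have exponent: "group_exponent (critical_group n G) = (LEAST k. 0 < k \<and> annihilates k)"
    using assms(1,2) quadratic_laplacian_axioms by (rule critical_group_exponent)
  \<comment> \<open>Each case thus reduces to an annihilator that divides all annihilators.\<close>
  have least: "group_exponent (critical_group n G) = e"
    if "0 < e" "annihilates e" "\<And>k. annihilates k \<Longrightarrow> e dvd k" for e
    unfolding exponent
  proof (rule Least_equality)
    show "0 < e \<and> annihilates e" using that by simp
    show "e \<le> k" if "0 < k \<and> annihilates k" for k
      using that \<open>\<And>k. annihilates k \<Longrightarrow> e dvd k\<close> dvd_imp_le by blast
  qed
  show ?thesis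
  proof (intro conjI impI allI)
    assume no: "(\<nexists>m. m \<ge> 2 \<and> K\<^bsub>m,m\<^esub> G) \<and> (\<nexists>p. p \<ge> 2 \<and> K\<^bsub>1,p\<^esub> G)"
    have "p dvd int k" if "annihilates k" for k
      using that
    proof (rule annihilates_dvd)
      show "card U \<noteq> card V" if "bipartition U V" "2 \<le> card U" for U V
      proof
        assume "card U = card V"
        then have "K\<^bsub>card U,card U\<^esub> G" unfolding K using that by metis
        then show False using no that by blast
      qed
      show "card V < 2" if "bipartition U V" "card U = 1" for U V
      proof (rule ccontr)
        have "K\<^bsub>1,card V\<^esub> G" unfolding K using that by metis
        moreover assume "\<not> card V < 2"
        ultimately show False using no by simp
      qed
    qed
    then have "group_exponent (critical_group n G) = nat p"
      using p_pos by (intro least annihilates_p) (simp_all add: nat_dvd_iff)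
    then show "real (group_exponent (critical_group n G)) = \<theta>\<^sub>1 * \<theta>\<^sub>2"
      using p p_pos by simp
  next
    fix m :: nat assume m: "2 \<le> m" "K\<^bsub>m,m\<^esub> G"
    then obtain U V where bip: "bipartition U V" "card U = m" "card V = m"
      by (auto simp: K)
    note Kmm = Kmm_exponent[OF bip m(1)]
    have "group_exponent (critical_group n G) = m\<^sup>2"
      using m(1) Kmm(2) by (intro least) simp_all
    then show "real (group_exponent (critical_group n G)) = \<theta>\<^sub>1 * \<theta>\<^sub>2 / 2"
      using p[symmetric] by (simp add: Kmm(1))
  next
    fix q :: nat assume q: "2 \<le> q" "K\<^bsub>1,q\<^esub> G"
    then obtain U V where bip: "bipartition U V" "card U = 1" "card V = q"
      by (auto simp: K)
    note star = star_exponent[OF bip q(1)]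
    \<comment> \<open>The critical group of a star is trivial, while the eigenvalue product is
      \<open>q + 1\<close>.\<close>
    have "group_exponent (critical_group n G) = 1"
      using star(2) by (intro least) simp_all
    then show "real (group_exponent (critical_group n G)) = \<theta>\<^sub>1 * \<theta>\<^sub>2 / (real q + 1)"
      using p[symmetric] by (simp add: star(1))
  qed
qed

end
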